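(* Let $f(x)\in\mathbb{Z}[x]$ be a monic irreducible monogenic polynomial, $K=\mathbb{Q}[x]/(f)$, $\alpha$ the image of $x$ in $K$, and $N$ a positive integer that is not a perfect power. Let $\tilde a_1(x),\dots,\tilde a_k(x)\in\mathbb{Z}[x]$ be monic polynomials such that for each $i$ there are $f_{1,i}(x),A_i(x)\in\mathbb{Z}[x]$ with $$f(x)=f_{1,i}(x)\,N+\tilde a_i(x)A_i(x),\qquad (f_{1,i}(x),\tilde a_i(x),N)=1\ \text{ in }\mathbb{Z}[x].$$ Then, as ideals of $O_K$, $$(N,\tilde a_1(\alpha))(N,\tilde a_2(\alpha))\cdots(N,\tilde a_k(\alpha))=(N^k,\ \tilde a_1(\alpha)\tilde a_2(\alpha)\cdots\tilde a_k(\alpha)).$$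
   Context: A monic irreducible $f\in\mathbb{Z}[x]$ is called monogenic if $[O_K:\mathbb{Z}[x]/(f)]=1$, where $O_K$ is the ring of integers of $K=\mathbb{Q}[x]/(f)$. "$(g,h,N)=1$ in $\mathbb{Z}[x]$" means that the ideal of $\mathbb{Z}[x]$ generated by $g,h,N$ is the whole ring. $(\beta_1,\beta_2)$ for elements of $O_K$ denotes the ideal of $O_K$ they generate. *)

theory Defs
  imports
    "HOL-Algebra.Algebraic_Closure_Type"
    "HOL-Algebra.Ideal_Product"
    "HOL-Algebra.QuotRing"
    "HOL-Computational_Algebra.Polynomial_Factorial"
    "HOL-Computational_Algebra.Nth_Powers"
begin

definition int_poly_eval :: "('a, 'b) ring_scheme \<Rightarrow> 'a \<Rightarrow> int poly \<Rightarrow> 'a" where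
  "int_poly_eval R u p =
     (\<Oplus>\<^bsub>R\<^esub>i\<in>{..Polynomial.degree p}. add_pow R (Polynomial.coeff p i) (u [^]\<^bsub>R\<^esub> i))"

definition defining_ideal :: "int poly \<Rightarrow> rat poly set" where
  "defining_ideal f = PIdl\<^bsub>ring_of_type_algebra\<^esub> (map_poly rat_of_int f)"

definition number_field :: "int poly \<Rightarrow> rat poly set ring" where
  "number_field f = ring_of_type_algebra Quot (defining_ideal f)"

definition root_class :: "int poly \<Rightarrow> rat poly set" where
  "root_class f = defining_ideal f +>\<^bsub>ring_of_type_algebra\<^esub> [:0, 1:]"

definition ring_of_integers :: "int poly \<Rightarrow> rat poly set ring" where
  "ring_of_integers f = (number_field f)
     \<lparr>carrier := {u \<in> carrier (number_field f).
        \<exists>p. lead_coeff p = 1 \<and> int_poly_eval (number_field f) u p = \<zero>\<^bsub>number_field f\<^esub>}\<rparr>"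

(* The image of Z[x]/(f) in Q[x]/(f). *)
definition equation_order :: "int poly \<Rightarrow> rat poly set set" where
  "equation_order f = range (int_poly_eval (number_field f) (root_class f))"

(* The cardinality is the additive group index; card is 0 for an infinite set of cosets,
   so the value 1 is attained only by a genuine index 1. *)
definition monogenic :: "int poly \<Rightarrow> bool" where
  "monogenic f \<longleftrightarrow> lead_coeff f = 1 \<and> Factorial_Ring.irreducible f \<and>
     card (a_rcosets\<^bsub>ring_of_integers f\<^esub> (equation_order f)) = 1"

definition perfect_power :: "nat \<Rightarrow> bool" where
  "perfect_power N \<longleftrightarrow> (\<exists>e\<ge>2. is_nth_power e N)"

end

theory Submission
  imports Defs "Jordan_Normal_Form.Char_Poly"
begin

text \<open>
  In \<open>O\<^sub>K\<close> write \<open>x\<close> for the image of \<open>N\<close> and \<open>b\<^sub>i\<close> for \<open>a\<^sub>i(\<alpha>)\<close>. The hypothesis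
  on \<open>a\<^sub>i\<close> says that \<open>x\<close> lies in the ideal \<open>(b\<^sub>i, x\<^sup>2)\<close>: multiply a relation
  \<open>u f\<^sub>1 + v a\<^sub>i + w N = 1\<close> by \<open>N\<close> and replace \<open>f\<^sub>1 N\<close> by \<open>- a\<^sub>i A\<close> modulo \<open>f\<close>
  (\<open>self_mem_genideal_modulo\<close>). Equivalently, \<open>x (1 - x w\<^sub>i) = b\<^sub>i c\<^sub>i\<close> for some
  \<open>c\<^sub>i\<close>, \<open>w\<^sub>i\<close>.

  From here on the statement is one about an arbitrary commutative ring
  (\<open>finprod_genideal_pair\<close>). Factors \<open>1 - x w\<close> are units modulo every power of \<open>x\<close>, and
  they are closed under products. So multiplying the relations gives
  \<open>x\<^sup>n (1 - x W) = P C\<close> with \<open>P\<close> the product of \<open>n\<close> of the \<open>b\<^sub>i\<close>. Expanding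
  \<open>(x\<^sup>n, P)(x, b)\<close> yields four generators; two are those of \<open>(x\<^sup>n\<^sup>+\<^sup>1, P b)\<close>, and the mixed
  ones \<open>x\<^sup>n b\<close> and \<open>P x\<close> are multiples of \<open>P b\<close> modulo \<open>x\<^sup>n\<^sup>+\<^sup>1\<close>, by the relation for
  \<open>P\<close> and by the one for \<open>b\<close> respectively. Induction on the number of factors finishes the
  argument.

  To use this, \<open>O\<^sub>K\<close> has to be known as a commutative ring containing \<open>\<alpha>\<close>. Monogenicity
  gives \<open>O\<^sub>K \<subseteq> \<int>[\<alpha>]\<close>. The reverse inclusion is the integrality of the elements of
  \<open>\<int>[\<alpha>]\<close>, proved with the characteristic polynomial of multiplication by \<open>p(\<alpha>)\<close> on the
  basis of powers of \<open>\<alpha>\<close> (\<open>monic_equation_modulo_monic\<close>). Hence \<open>O\<^sub>K\<close> is the image of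
  \<open>\<int>[x]\<close> under the ring homomorphism \<open>p \<mapsto> p(\<alpha>)\<close>.
\<close>

section \<open>Integral equations modulo a monic polynomial\<close>

text \<open>
  Every element of \<open>R[x]/(f)\<close> is integral over \<open>R\<close>. The polynomial \<open>q\<close> is the
  characteristic polynomial of the matrix \<open>M\<close> of multiplication by \<open>p\<close> on
  \<open>1, x, \<dots>, x\<^sup>n\<^sup>-\<^sup>1\<close>. The vector of these powers is killed modulo \<open>f\<close> by
  \<open>B = p \<cdot> 1 - M\<close>. Multiplying by the adjugate of \<open>B\<close>, the vector is killed by
  \<open>det B = q(p)\<close>, and its first entry is \<open>1\<close>.
\<close>

lemma monic_equation_modulo_monic:
  fixes f p :: "'a::comm_ring_1 poly"
  assumes monic: "lead_coeff f = 1"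
  shows "\<exists>q. lead_coeff q = 1 \<and> f dvd pcompose q p"
proof (cases "degree f = 0")
  case True
  then have "f = 1"
    using monic by (metis degree_0_id one_poly_eq_simps(1))
  then show ?thesis
    by (intro exI[of _ 1]) simp
next
  case False
  define n where "n = degree f"
  have n: "n > 0"
    using False by (simp add: n_def)
  have f0: "f \<noteq> 0"
    using monic by auto
  \<comment> \<open>Division with remainder by the monic \<open>f\<close> works over any coefficient ring; \<open>r j\<close> will be row \<open>j\<close> of \<open>M\<close>.\<close>
  have "\<exists>r. degree r < n \<and> f dvd monom 1 j * p - r" for j
  proof -
    obtain q r where qr: "pseudo_divmod (monom 1 j * p) f = (q, r)"
      by (cases "pseudo_divmod (monom 1 j * p) f")
    note D = pseudo_divmod[OF f0 qr]
    from D(1) monic have "monom 1 j * p = f * q + r" by simp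
    then have "f dvd monom 1 j * p - r" by simp
    moreover have "degree r < n"
      using D(2) n by (auto simp: n_def)
    ultimately show ?thesis by blast
  qed
  then obtain r where deg_r: "\<And>j. degree (r j) < n"
    and r_cong: "\<And>j. f dvd monom 1 j * p - r j"
    by metis
  define M where "M = mat n n (\<lambda>(j, i). coeff (r j) i)"
  have M: "M \<in> carrier_mat n n"
    by (simp add: M_def)
  have hom: "comm_ring_hom (\<lambda>q. pcompose q p)"
    by unfold_locales (simp_all add: pcompose_add pcompose_mult)
  define B where "B = map_mat (\<lambda>q. pcompose q p) (char_poly_matrix M)"
  have B: "B \<in> carrier_mat n n"
    using M by (simp add: B_def)
  have det_B: "det B = pcompose (char_poly M) p"
    unfolding B_def char_poly_def by (rule comm_ring_hom.hom_det[OF hom])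
  define v where "v = vec n (\<lambda>i. monom (1::'a) i)"
  have v: "v \<in> carrier_vec n"
    by (simp add: v_def)
  have Bv: "(B *\<^sub>v v) $ j = monom 1 j * p - r j" if j: "j < n" for j
  proof -
    have B_entry: "B $$ (j, i) = (if i = j then p else 0) - [:coeff (r j) i:]" if "i < n" for i
      using j that M by (auto simp: B_def char_poly_matrix_def M_def pcompose_pCons)
    have "(B *\<^sub>v v) $ j = (\<Sum>i<n. B $$ (j, i) * monom 1 i)"
      using B j by (simp add: v_def scalar_prod_def atLeast0LessThan)
    also have "\<dots> = (\<Sum>i<n. (if i = j then p * monom 1 i else 0) - monom (coeff (r j) i) i)"
      by (rule sum.cong) (auto simp: B_entry left_diff_distrib smult_monom)
    also have "\<dots> = p * monom 1 j - (\<Sum>i<n. monom (coeff (r j) i) i)"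
      using j by (simp add: sum_subtractf)
    also have "(\<Sum>i<n. monom (coeff (r j) i) i) = r j"
    proof -
      have "(\<Sum>i\<le>n - 1. monom (coeff (r j) i) i) = r j"
        using deg_r[of j] by (intro poly_as_sum_of_monoms') simp
      moreover have "{..n - 1} = {..<n}"
        using n by auto
      ultimately show ?thesis by simp
    qed
    finally show ?thesis
      by (simp add: mult.commute)
  qed
  have adj: "adj_mat B \<in> carrier_mat n n"
    using adj_mat(1)[OF B] .
  \<comment> \<open>Row \<open>0\<close> of the adjugate identity, applied to the vector of powers.\<close>
  have "det B = (det B \<cdot>\<^sub>m 1\<^sub>m n *\<^sub>v v) $ 0"
    using n by (simp add: v_def)
  also have "det B \<cdot>\<^sub>m 1\<^sub>m n *\<^sub>v v = adj_mat B *\<^sub>v (B *\<^sub>v v)"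
    using assoc_mult_mat_vec[OF adj B v] adj_mat(3)[OF B] by simp
  also have "\<dots> $ 0 = (\<Sum>j<n. adj_mat B $$ (0, j) * (B *\<^sub>v v) $ j)"
    using adj B n by (simp add: scalar_prod_def atLeast0LessThan)
  also have "f dvd \<dots>"
    by (intro dvd_sum dvd_mult) (simp add: Bv r_cong)
  finally have "f dvd pcompose (char_poly M) p"
    by (simp add: det_B)
  moreover have "lead_coeff (char_poly M) = 1"
    using degree_monic_char_poly[OF M] by simp
  ultimately show ?thesis by blast
qed

section \<open>Products of two-generated ideals\<close>

lemma (in cring) genideal_insertE:
  assumes "y \<in> Idl (insert a S)" "a \<in> carrier R" "S \<subseteq> carrier R"
  obtains r s where "r \<in> carrier R" "s \<in> Idl S" "y = r \<otimes> a \<oplus> s"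
proof -
  have S: "ideal (Idl S) R"
    using assms(3) by (rule genideal_ideal)
  have a: "ideal (PIdl a) R"
    using assms(2) by (rule cgenideal_ideal)
  have "insert a S \<subseteq> PIdl a <+> Idl S"
  proof
    fix z assume "z \<in> insert a S"
    then consider "z = a" | "z \<in> S" by blast
    then show "z \<in> PIdl a <+> Idl S"
    proof cases
      case 1
      then have "z = a \<oplus> \<zero>" "a \<in> PIdl a" "\<zero> \<in> Idl S"
        using assms(2) cgenideal_self S
        by (simp_all add: additive_subgroup.zero_closed ideal.axioms(1))
      then show ?thesis by (auto simp: set_add_def')
    next
      case 2
      then have "z = \<zero> \<oplus> z" "\<zero> \<in> PIdl a" "z \<in> Idl S"
        using assms(3) genideal_self[OF assms(3)] a
        by (auto simp: additive_subgroup.zero_closed ideal.axioms(1))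
      then show ?thesis by (auto simp: set_add_def')
    qed
  qed
  then have "Idl (insert a S) \<subseteq> PIdl a <+> Idl S"
    by (rule genideal_minimal[OF add_ideals[OF a S]])
  with assms(1) that show ?thesis
    by (auto simp: set_add_def' cgenideal_def)
qed

lemma (in cring) genideal_singletonE:
  assumes "y \<in> Idl {a}" "a \<in> carrier R"
  obtains r where "r \<in> carrier R" "y = r \<otimes> a"
  using assms by (auto simp: cgenideal_eq_genideal[symmetric] cgenideal_def)

lemma (in cring) in_genideal_pairI:
  assumes "r \<in> carrier R" "s \<in> carrier R" "a \<in> carrier R" "b \<in> carrier R"
  shows "r \<otimes> a \<oplus> s \<otimes> b \<in> Idl {a, b}"
proof -
  interpret I: ideal "Idl {a, b}" R
    using assms by (intro genideal_ideal) auto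
  show ?thesis
    using assms genideal_self[of "{a, b}"] by (simp add: I.I_l_closed)
qed

lemma (in cring) genideal_pair_prod:
  assumes "a \<in> carrier R" "b \<in> carrier R" "c \<in> carrier R" "d \<in> carrier R"
  shows "(Idl {a, b}) \<cdot> (Idl {c, d}) = Idl {a \<otimes> c, a \<otimes> d, b \<otimes> c, b \<otimes> d}"
    (is "?I \<cdot> ?J = Idl ?G")
proof (rule subset_antisym)
  have I: "ideal ?I R" and J: "ideal ?J R"
    using assms by (auto intro!: genideal_ideal)
  have G: "?G \<subseteq> carrier R"
    using assms by auto
  have "?G \<subseteq> ?I \<cdot> ?J"
    using assms genideal_self[of "{a, b}"] genideal_self[of "{c, d}"]
    by (auto intro!: ideal_prod.prod)
  then show "Idl ?G \<subseteq> ?I \<cdot> ?J"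
    by (rule genideal_minimal[OF ideal_prod_is_ideal[OF I J]])
  interpret IG: ideal "Idl ?G" R
    using G by (rule genideal_ideal)
  have g: "a \<otimes> c \<in> Idl ?G" "a \<otimes> d \<in> Idl ?G" "b \<otimes> c \<in> Idl ?G" "b \<otimes> d \<in> Idl ?G"
    using genideal_self[OF G] by auto
  show "?I \<cdot> ?J \<subseteq> Idl ?G"
  proof
    fix z assume "z \<in> ?I \<cdot> ?J"
    then show "z \<in> Idl ?G"
    proof induction
      case (prod i j)
      obtain r s where i: "r \<in> carrier R" "s \<in> carrier R" "i = r \<otimes> a \<oplus> s \<otimes> b"
        using prod(1) assms by (auto elim!: genideal_insertE genideal_singletonE)
      obtain t u where j: "t \<in> carrier R" "u \<in> carrier R" "j = t \<otimes> c \<oplus> u \<otimes> d"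
        using prod(2) assms by (auto elim!: genideal_insertE genideal_singletonE)
      have "i \<otimes> j = (r \<otimes> t) \<otimes> (a \<otimes> c) \<oplus> (r \<otimes> u) \<otimes> (a \<otimes> d)
        \<oplus> (s \<otimes> t) \<otimes> (b \<otimes> c) \<oplus> (s \<otimes> u) \<otimes> (b \<otimes> d)"
        using i j assms by algebra
      then show ?case
        using i j g by (auto intro!: IG.a_closed IG.I_l_closed)
    next
      case (sum s1 s2)
      then show ?case by (intro IG.a_closed)
    qed
  qed
qed

text \<open>
  The witness \<open>g\<close> is the geometric sum. It is the inverse of \<open>1 - y\<close> modulo \<open>y\<^sup>n\<close>.
\<close>

lemma (in cring) one_minus_dvd_one_minus_pow:
  assumes y: "y \<in> carrier R"
  shows "\<exists>g\<in>carrier R. (\<one> \<ominus> y) \<otimes> g = \<one> \<ominus> y [^] (n::nat)"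
proof (induction n)
  case 0
  have "(\<one> \<ominus> y) \<otimes> \<zero> = \<one> \<ominus> \<one>"
    using y by algebra
  then show ?case by (intro bexI[of _ \<zero>]) auto
next
  case (Suc n)
  then obtain g where g: "g \<in> carrier R" "(\<one> \<ominus> y) \<otimes> g = \<one> \<ominus> y [^] n" by blast
  have yn: "y [^] n \<in> carrier R" using y by simp
  have "(\<one> \<ominus> y) \<otimes> (g \<oplus> y [^] n) = (\<one> \<ominus> y) \<otimes> g \<oplus> (y [^] n \<ominus> y [^] n \<otimes> y)"
    using y yn g(1) by algebra
  also have "\<dots> = \<one> \<ominus> y [^] Suc n"
    unfolding g(2) nat_pow_Suc using y yn by algebra
  finally show ?case using g y by (intro bexI[of _ "g \<oplus> y [^] n"]) auto
qed

text \<open>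
  The induction step. Since \<open>x\<^sup>n = P C + x\<^sup>n\<^sup>+\<^sup>1 W\<close>, the generator \<open>x\<^sup>n b\<close> lies in the right-hand
  ideal. For \<open>P x\<close> a relation modulo \<open>x\<^sup>2\<close> is too weak: it is sharpened to
  \<open>x \<in> (b, x\<^sup>n\<^sup>+\<^sup>1)\<close> by inverting \<open>1 - x w\<close> modulo \<open>x\<^sup>n\<close>.
\<close>

lemma (in cring) genideal_pair_prod_step:
  assumes car: "x \<in> carrier R" "P \<in> carrier R" "C \<in> carrier R" "W \<in> carrier R"
      "b \<in> carrier R" "c \<in> carrier R" "w \<in> carrier R"
    and P: "x [^] n \<otimes> (\<one> \<ominus> x \<otimes> W) = P \<otimes> C"
    and b: "x \<otimes> (\<one> \<ominus> x \<otimes> w) = b \<otimes> c"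
  shows "(Idl {x [^] (n::nat), P}) \<cdot> (Idl {x, b}) = Idl {x [^] Suc n, P \<otimes> b}"
proof (rule subset_antisym)
  let ?q = "x [^] n"
  let ?J = "Idl {x [^] Suc n, P \<otimes> b}"
  have q: "?q \<in> carrier R" using car by simp
  interpret J: ideal ?J R
    using car by (intro genideal_ideal) auto
  have gen: "x [^] Suc n \<in> ?J" "P \<otimes> b \<in> ?J"
  proof -
    have "{x [^] Suc n, P \<otimes> b} \<subseteq> carrier R"
      using car by simp
    from genideal_self[OF this] show "x [^] Suc n \<in> ?J" "P \<otimes> b \<in> ?J"
      by blast+
  qed
  have qb: "?q \<otimes> b \<in> ?J"
  proof -
    have "?q \<otimes> b = (?q \<otimes> (\<one> \<ominus> x \<otimes> W)) \<otimes> b \<oplus> (W \<otimes> b) \<otimes> (x [^] Suc n)"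
      unfolding nat_pow_Suc using car q by algebra
    also have "\<dots> = (W \<otimes> b) \<otimes> (x [^] Suc n) \<oplus> C \<otimes> (P \<otimes> b)"
      unfolding P nat_pow_Suc using car q by algebra
    also have "\<dots> \<in> ?J"
      using car by (intro in_genideal_pairI) simp_all
    finally show ?thesis .
  qed
  have Px: "P \<otimes> x \<in> ?J"
  proof -
    obtain g where g: "g \<in> carrier R" "(\<one> \<ominus> x \<otimes> w) \<otimes> g = \<one> \<ominus> (x \<otimes> w) [^] n"
      using one_minus_dvd_one_minus_pow[OF m_closed[OF car(1) car(7)], of n] by blast
    have e: "(x \<otimes> w) [^] n = ?q \<otimes> w [^] n"
      using car(1,7) by (rule nat_pow_distrib)
    have wn: "w [^] n \<in> carrier R" using car by simp
    have "P \<otimes> x = P \<otimes> x \<otimes> (\<one> \<ominus> (x \<otimes> w) [^] n) \<oplus> P \<otimes> x \<otimes> (?q \<otimes> w [^] n)"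
      unfolding e using car q wn by algebra
    also have "\<dots> = P \<otimes> (x \<otimes> (\<one> \<ominus> x \<otimes> w)) \<otimes> g \<oplus> P \<otimes> x \<otimes> (?q \<otimes> w [^] n)"
      unfolding g(2)[symmetric] using car g(1) q wn by algebra
    also have "\<dots> = (P \<otimes> w [^] n) \<otimes> (x [^] Suc n) \<oplus> (c \<otimes> g) \<otimes> (P \<otimes> b)"
      unfolding b nat_pow_Suc using car g(1) q wn by algebra
    also have "\<dots> \<in> ?J"
      using car g(1) by (intro in_genideal_pairI) simp_all
    finally show ?thesis .
  qed
  have "{?q \<otimes> x, ?q \<otimes> b, P \<otimes> x, P \<otimes> b} \<subseteq> ?J"
    using gen qb Px unfolding nat_pow_Suc[symmetric] by blast
  then show "(Idl {?q, P}) \<cdot> (Idl {x, b}) \<subseteq> ?J"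
    unfolding genideal_pair_prod[OF q car(2) car(1) car(5)]
    by (rule genideal_minimal[OF J.is_ideal])
  show "?J \<subseteq> (Idl {?q, P}) \<cdot> (Idl {x, b})"
    unfolding genideal_pair_prod[OF q car(2) car(1) car(5)] nat_pow_Suc
    using car by (intro subset_Idl_subset) auto
qed

text \<open>
  The ideal \<open>(x, b\<^sub>i)\<close> behaves multiplicatively because \<open>x\<close> is, up to a factor that is a unit
  modulo powers of \<open>x\<close>, a multiple of \<open>b\<^sub>i\<close>. The induction carries along the same
  relation between \<open>x\<^sup>n\<close> and the product of the \<open>b\<^sub>i\<close>.
\<close>

lemma (in cring) finprod_genideal_pair:
  assumes "finite I" "x \<in> carrier R" "b \<in> I \<rightarrow> carrier R"
    and mem: "\<And>i. i \<in> I \<Longrightarrow> x \<in> Idl {b i, x \<otimes> x}"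
  shows "(\<Otimes>\<^bsub>ideals_set R\<^esub>i\<in>I. Idl {x, b i}) = Idl {x [^] card I, \<Otimes>i\<in>I. b i}"
proof -
  interpret S: comm_monoid "ideals_set R"
    by (rule ideals_set_is_comm_monoid)
  have "(\<Otimes>\<^bsub>ideals_set R\<^esub>i\<in>I. Idl {x, b i}) = Idl {x [^] card I, \<Otimes>i\<in>I. b i} \<and>
    (\<exists>C\<in>carrier R. \<exists>W\<in>carrier R. x [^] card I \<otimes> (\<one> \<ominus> x \<otimes> W) = (\<Otimes>i\<in>I. b i) \<otimes> C)"
    using assms
  proof (induction I rule: finite_induct)
    case empty
    have "\<one> \<otimes> (\<one> \<ominus> x \<otimes> \<zero>) = \<one> \<otimes> \<one>"
      using empty by algebra
    moreover have "one (ideals_set R) = Idl {\<one>}"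
      by (simp add: ideals_set_def genideal_one)
    moreover have "(\<Otimes>\<^bsub>ideals_set R\<^esub>i\<in>{}. Idl {x, b i}) = one (ideals_set R)"
      by (rule S.finprod_empty)
    ultimately show ?case
      by (intro conjI bexI[of _ \<one>] bexI[of _ \<zero>]) simp_all
  next
    case (insert i I)
    have x: "x \<in> carrier R" and bI: "b \<in> I \<rightarrow> carrier R" and bi: "b i \<in> carrier R"
      using insert.prems by auto
    let ?P = "\<Otimes>i\<in>I. b i"
    have P: "?P \<in> carrier R" using bI by simp
    from insert.IH[OF x bI] insert.prems(3) obtain C W where
      IH: "(\<Otimes>\<^bsub>ideals_set R\<^esub>i\<in>I. Idl {x, b i}) = Idl {x [^] card I, ?P}" and
      CW: "C \<in> carrier R" "W \<in> carrier R" "x [^] card I \<otimes> (\<one> \<ominus> x \<otimes> W) = ?P \<otimes> C"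
      by auto
    obtain c w where cw: "c \<in> carrier R" "w \<in> carrier R" "x = c \<otimes> b i \<oplus> w \<otimes> (x \<otimes> x)"
      using insert.prems(3)[of i] bi x by (auto elim!: genideal_insertE genideal_singletonE)
    have b_eq: "x \<otimes> (\<one> \<ominus> x \<otimes> w) = b i \<otimes> c"
    proof -
      have "x \<otimes> (\<one> \<ominus> x \<otimes> w) = x \<ominus> w \<otimes> (x \<otimes> x)"
        using x cw(2) by algebra
      also have "\<dots> = (c \<otimes> b i \<oplus> w \<otimes> (x \<otimes> x)) \<ominus> w \<otimes> (x \<otimes> x)"
        using cw(3) by simp
      also have "\<dots> = b i \<otimes> c"
        using x bi cw(1,2) by algebra
      finally show ?thesis .
    qed
    have "(\<Otimes>\<^bsub>ideals_set R\<^esub>j\<in>insert i I. Idl {x, b j}) =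
        Idl {x, b i} \<otimes>\<^bsub>ideals_set R\<^esub> (\<Otimes>\<^bsub>ideals_set R\<^esub>j\<in>I. Idl {x, b j})"
      using insert.hyps bI bi x
      by (intro S.finprod_insert) (auto simp: ideals_set_def intro!: genideal_ideal)
    also have "\<dots> = (Idl {x [^] card I, ?P}) \<cdot> (Idl {x, b i})"
      unfolding IH using x P bi
      by (subst ideal_prod_commute) (auto simp: ideals_set_def intro!: genideal_ideal)
    also have "\<dots> = Idl {x [^] Suc (card I), ?P \<otimes> b i}"
      using genideal_pair_prod_step[OF x P CW(1,2) bi cw(1,2) CW(3) b_eq] .
    also have "\<dots> = Idl {x [^] card (insert i I), \<Otimes>j\<in>insert i I. b j}"
      using insert.hyps bI bi P by (simp add: m_comm)
    finally have 1: "(\<Otimes>\<^bsub>ideals_set R\<^esub>j\<in>insert i I. Idl {x, b j}) =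
      Idl {x [^] card (insert i I), \<Otimes>j\<in>insert i I. b j}" .
    have q: "x [^] card I \<in> carrier R" using x by simp
    \<comment> \<open>The new \<open>W\<close> is read off from \<open>(1 - x W)(1 - x w) = 1 - x (W + w - x W w)\<close>.\<close>
    have "x [^] Suc (card I) \<otimes> (\<one> \<ominus> x \<otimes> (W \<oplus> w \<ominus> x \<otimes> W \<otimes> w)) =
      (x [^] card I \<otimes> (\<one> \<ominus> x \<otimes> W)) \<otimes> (x \<otimes> (\<one> \<ominus> x \<otimes> w))"
      unfolding nat_pow_Suc using x q CW(1,2) cw(1,2) by algebra
    also have "\<dots> = (b i \<otimes> ?P) \<otimes> (C \<otimes> c)"
      unfolding CW(3) b_eq using P bi CW(1,2) cw(1,2) by algebra
    finally have "\<exists>C\<in>carrier R. \<exists>W\<in>carrier R.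
      x [^] card (insert i I) \<otimes> (\<one> \<ominus> x \<otimes> W) = (\<Otimes>j\<in>insert i I. b j) \<otimes> C"
      using insert.hyps bI bi x CW(1,2) cw(1,2)
      by (intro bexI[of _ "C \<otimes> c"] bexI[of _ "W \<oplus> w \<ominus> x \<otimes> W \<otimes> w"]) auto
    with 1 show ?case by blast
  qed
  then show ?thesis ..
qed

section \<open>Type class rings as explicit rings\<close>

context comm_ring_1
begin

lemma ring_of_type_algebra_simps [simp]:
  "carrier (ring_of_type_algebra :: 'a ring) = UNIV"
  "x \<oplus>\<^bsub>ring_of_type_algebra\<^esub> y = x + y"
  "x \<otimes>\<^bsub>ring_of_type_algebra\<^esub> y = x * y"
  "\<zero>\<^bsub>ring_of_type_algebra\<^esub> = (0 :: 'a)"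
  "\<one>\<^bsub>ring_of_type_algebra\<^esub> = (1 :: 'a)"
  by (simp_all add: ring_of_type_algebra_def)

end

lemma ring_of_type_algebra_pow:
  "x [^]\<^bsub>ring_of_type_algebra\<^esub> (n :: nat) = (x ^ n :: 'a::comm_ring_1)"
proof -
  interpret R: cring "ring_of_type_algebra :: 'a ring" by (rule cring_from_type_algebra)
  show ?thesis by (induction n) (simp_all add: mult.commute)
qed

lemma ring_of_type_algebra_a_inv:
  "\<ominus>\<^bsub>ring_of_type_algebra\<^esub> x = (- x :: 'a::comm_ring_1)"
proof -
  interpret R: cring "ring_of_type_algebra :: 'a ring" by (rule cring_from_type_algebra)
  show ?thesis by (rule R.minus_equality) simp_all
qed

lemma ring_of_type_algebra_add_pow:
  "add_pow ring_of_type_algebra (n :: int) x = (of_int n * x :: 'a::comm_ring_1)"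
proof -
  interpret R: cring "ring_of_type_algebra :: 'a ring" by (rule cring_from_type_algebra)
  have nat: "add_pow ring_of_type_algebra m x = of_nat m * x" for m :: nat
  proof (induction m)
    case (Suc m)
    then show ?case by (simp add: distrib_right add.commute[of x])
  qed simp
  show ?thesis
    by (cases "n \<ge> 0") (simp_all add: add_pow_int_ge add_pow_int_lt nat ring_of_type_algebra_a_inv)
qed

lemma ring_of_type_algebra_finsum:
  assumes "finite A"
  shows "finsum ring_of_type_algebra g A = (sum g A :: 'a::comm_ring_1)"
proof -
  interpret R: cring "ring_of_type_algebra :: 'a ring" by (rule cring_from_type_algebra)
  show ?thesis using assms by (induction A) simp_all
qed

text \<open>
  In \<open>\<int>[x]\<close> itself, evaluation is composition. Evaluations in \<open>K\<close> are reduced to this case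
  by pushing them through the homomorphism \<open>\<int>[x] \<rightarrow> K\<close>.
\<close>

lemma int_poly_eval_eq_pcompose:
  "int_poly_eval ring_of_type_algebra u q = pcompose q u"
  by (simp add: int_poly_eval_def ring_of_type_algebra_finsum ring_of_type_algebra_pow
    ring_of_type_algebra_add_pow pcompose_altdef poly_altdef of_int_poly degree_map_poly
    coeff_map_poly)

lemma ring_hom_int_poly_eval:
  assumes "ring_hom_cring R S h" "u \<in> carrier R"
  shows "h (int_poly_eval R u q) = int_poly_eval S (h u) q"
proof -
  interpret ring_hom_cring R S h by fact
  have ap: "h (add_pow R (n::int) v) = add_pow S n (h v)" if "v \<in> carrier R" for n v
  proof -
    have nat: "h (add_pow R m v) = add_pow S m (h v)" for m :: nat
      using that by (induction m) simp_all
    show ?thesis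
      using that by (cases "n \<ge> 0") (simp_all add: add_pow_int_ge add_pow_int_lt nat)
  qed
  have pw: "h (u [^]\<^bsub>R\<^esub> n) = h u [^]\<^bsub>S\<^esub> n" for n :: nat
    using assms(2) by (induction n) simp_all
  have "h (int_poly_eval R u q) =
    (\<Oplus>\<^bsub>S\<^esub>i\<in>{..Polynomial.degree q}. (h \<circ> (\<lambda>i. add_pow R (Polynomial.coeff q i) (u [^]\<^bsub>R\<^esub> i))) i)"
    unfolding int_poly_eval_def using assms(2)
    by (subst hom_finsum) (auto simp: comp_def)
  then show ?thesis
    using assms(2) by (simp add: int_poly_eval_def ap pw)
qed

section \<open>The ring of integers of a monogenic polynomial\<close>

text \<open>
  The value \<open>p(\<alpha>)\<close>, encoded as the coset of \<open>p\<close>, so that being a ring homomorphism in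
  \<open>p\<close> is inherited from the quotient map.
\<close>

definition int_poly_class :: "int poly \<Rightarrow> int poly \<Rightarrow> rat poly set" where
  "int_poly_class f p =
     defining_ideal f +>\<^bsub>ring_of_type_algebra\<^esub> map_poly rat_of_int p"

lemma ring_hom_cring_int_poly_class:
  "ring_hom_cring ring_of_type_algebra (number_field f) (int_poly_class f)"
proof -
  interpret Q: cring "ring_of_type_algebra :: rat poly ring"
    by (rule cring_from_type_algebra)
  interpret I: ideal "defining_ideal f" "ring_of_type_algebra :: rat poly ring"
    unfolding defining_ideal_def by (rule Q.cgenideal_ideal) simp
  interpret q: ring_hom_cring "ring_of_type_algebra :: rat poly ring" "number_field f"
      "\<lambda>p. defining_ideal f +>\<^bsub>ring_of_type_algebra\<^esub> p"
    unfolding number_field_def by (rule I.rcos_ring_hom_cring[OF Q.is_cring])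
  show ?thesis
  proof (intro ring_hom_cring.intro ring_hom_cring_axioms.intro)
    show "cring (ring_of_type_algebra :: int poly ring)"
      by (rule cring_from_type_algebra)
    show "cring (number_field f)" by (rule q.S.is_cring)
    show "int_poly_class f \<in> Ring.ring_hom ring_of_type_algebra (number_field f)"
      using q.hom_add q.hom_mult q.hom_one
      by (intro ring_hom_memI)
        (simp_all add: int_poly_class_def of_int_poly_hom.hom_add of_int_poly_hom.hom_mult)
  qed
qed

lemma int_poly_class_eq_zero:
  assumes "f dvd p"
  shows "int_poly_class f p = \<zero>\<^bsub>number_field f\<^esub>"
proof -
  interpret Q: cring "ring_of_type_algebra :: rat poly ring"
    by (rule cring_from_type_algebra)
  interpret I: ideal "defining_ideal f" "ring_of_type_algebra :: rat poly ring"
    unfolding defining_ideal_def by (rule Q.cgenideal_ideal) simp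
  from assms obtain g where "p = g * f" by (auto simp: dvd_def mult.commute)
  then have "map_poly rat_of_int p \<in> defining_ideal f"
    by (auto simp: defining_ideal_def cgenideal_def of_int_poly_hom.hom_mult)
  then show ?thesis
    by (simp add: int_poly_class_def number_field_def FactRing_def I.a_rcos_const)
qed

lemma int_poly_eval_root_class:
  "int_poly_eval (number_field f) (root_class f) p = int_poly_class f p"
proof -
  have "root_class f = int_poly_class f [:0, 1:]"
    by (simp add: root_class_def int_poly_class_def map_poly_pCons)
  then show ?thesis
    using ring_hom_int_poly_eval[OF ring_hom_cring_int_poly_class, of "[:0, 1:]" f p]
    by (simp add: int_poly_eval_eq_pcompose pcompose_idR)
qed

text \<open>
  \<open>O\<^sub>K = \<int>[\<alpha>]\<close>. The inclusion of \<open>\<int>[\<alpha>]\<close> in \<open>O\<^sub>K\<close> is integrality. For the other one,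
  index \<open>1\<close> means that the coset of any \<open>x \<in> O\<^sub>K\<close> coincides with the coset of \<open>0\<close>, which
  is \<open>\<int>[\<alpha>]\<close>.
\<close>

lemma carrier_ring_of_integers:
  assumes monic: "lead_coeff f = 1" and "monogenic f"
  shows "carrier (ring_of_integers f) = range (int_poly_class f)"
proof -
  interpret h: ring_hom_cring ring_of_type_algebra "number_field f" "int_poly_class f"
    by (rule ring_hom_cring_int_poly_class)
  let ?O = "ring_of_integers f"
  have order: "equation_order f = range (int_poly_class f)"
    by (simp add: equation_order_def int_poly_eval_root_class)
  have K: "carrier ?O \<subseteq> carrier (number_field f)"
    by (auto simp: ring_of_integers_def)
  have "int_poly_class f p \<in> carrier ?O" for p
  proof -
    obtain q where q: "lead_coeff q = 1" "f dvd pcompose q p"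
      using monic_equation_modulo_monic[OF monic] by blast
    have "int_poly_eval (number_field f) (int_poly_class f p) q = int_poly_class f (pcompose q p)"
      using ring_hom_int_poly_eval[OF ring_hom_cring_int_poly_class, of p f q]
      by (simp add: int_poly_eval_eq_pcompose)
    with q have "lead_coeff q = 1 \<and>
        int_poly_eval (number_field f) (int_poly_class f p) q = \<zero>\<^bsub>number_field f\<^esub>"
      by (simp add: int_poly_class_eq_zero)
    then show ?thesis
      by (auto simp: ring_of_integers_def)
  qed
  moreover have "x \<in> range (int_poly_class f)" if x: "x \<in> carrier ?O" for x
  proof -
    let ?coset = "\<lambda>y. {h \<oplus>\<^bsub>number_field f\<^esub> y |h. h \<in> range (int_poly_class f)}"
    \<comment> \<open>\<open>O\<^sub>K\<close> inherits its addition from \<open>K\<close>, so its cosets can be written with that of \<open>K\<close>.\<close>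
    have "a_rcosets\<^bsub>?O\<^esub> (equation_order f) = ?coset ` carrier ?O"
      unfolding order by (auto simp: A_RCOSETS_def RCOSETS_def r_coset_def ring_of_integers_def)
    then have "card (?coset ` carrier ?O) = 1"
      using assms(2) by (simp add: monogenic_def)
    then obtain D where D: "?coset ` carrier ?O = {D}"
      by (rule card_1_singletonE)
    have coset_eq: "?coset y = D" if "y \<in> carrier ?O" for y
      using imageI[OF that, of ?coset] unfolding D by (rule singletonD)
    have "\<zero>\<^bsub>number_field f\<^esub> \<in> carrier ?O"
      using \<open>\<And>p. int_poly_class f p \<in> carrier ?O\<close>[of 0] h.hom_zero by simp
    then have coset_0: "?coset x = ?coset \<zero>\<^bsub>number_field f\<^esub>"
      using x coset_eq by (simp only:)
    have "x = int_poly_class f 0 \<oplus>\<^bsub>number_field f\<^esub> x"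
      using x K h.hom_zero by auto
    then have "x \<in> ?coset x" by blast
    then have "x \<in> ?coset \<zero>\<^bsub>number_field f\<^esub>"
      unfolding coset_0 .
    then show ?thesis
      using h.hom_closed by auto
  qed
  ultimately show ?thesis by (intro subset_antisym subsetI) auto
qed

lemma ring_hom_cring_ring_of_integers:
  assumes "lead_coeff f = 1" "monogenic f"
  shows "ring_hom_cring ring_of_type_algebra (ring_of_integers f) (int_poly_class f)"
proof -
  interpret h: ring_hom_cring ring_of_type_algebra "number_field f" "int_poly_class f"
    by (rule ring_hom_cring_int_poly_class)
  have hom_ring: "ring_hom_ring ring_of_type_algebra (number_field f) (int_poly_class f)"
    by (rule ring_hom_ringI2) (rule h.R.ring_axioms h.S.ring_axioms h.homh)+
  have O: "ring_of_integers f = (number_field f)\<lparr>carrier := range (int_poly_class f)\<rparr>"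
    using carrier_ring_of_integers[OF assms] by (simp add: ring_of_integers_def)
  show ?thesis
    unfolding O
  proof (intro ring_hom_cring.intro ring_hom_cring_axioms.intro)
    show "cring (ring_of_type_algebra :: int poly ring)" ..
    show "cring ((number_field f)\<lparr>carrier := range (int_poly_class f)\<rparr>)"
      using ring_hom_ring.img_is_cring[OF hom_ring h.S.is_cring] by simp
    show "int_poly_class f \<in>
      Ring.ring_hom ring_of_type_algebra ((number_field f)\<lparr>carrier := range (int_poly_class f)\<rparr>)"
      using h.hom_add h.hom_mult h.hom_one by (intro ring_hom_memI) simp_all
  qed
qed

section \<open>The product formula\<close>

text \<open>
  The divisibility says \<open>N \<in> (a, N\<^sup>2)\<close> in \<open>\<int>[x]/(f)\<close>. It is the form in which
  the coprimality of \<open>f\<^sub>1\<close>, \<open>a\<close> and \<open>N\<close> enters the ideal computation.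
\<close>

lemma self_mem_genideal_modulo:
  fixes f f1 a A :: "int poly"
  assumes f: "f = f1 * of_nat N + a * A"
    and unit: "Idl\<^bsub>ring_of_type_algebra\<^esub> {f1, a, of_nat N} = UNIV"
  obtains c w where "f dvd of_nat N - (c * a + w * (of_nat N * of_nat N))"
proof -
  interpret R: cring "ring_of_type_algebra :: int poly ring"
    by (rule cring_from_type_algebra)
  have "1 \<in> Idl\<^bsub>ring_of_type_algebra\<^esub> {f1, a, of_nat N}"
    using unit by simp
  then obtain u v w where uvw: "1 = u * f1 + (v * a + w * of_nat N)"
    by (auto elim!: R.genideal_insertE R.genideal_singletonE)
  \<comment> \<open>In \<open>N u f\<^sub>1\<close> the factor \<open>N f\<^sub>1\<close> equals \<open>f - a A\<close>, whence the coefficient \<open>v N - u A\<close> of \<open>a\<close>.\<close>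
  have "of_nat N = of_nat N * (u * f1 + (v * a + w * of_nat N))"
    by (simp flip: uvw)
  then have "of_nat N - ((v * of_nat N - u * A) * a + w * (of_nat N * of_nat N)) = f * u"
    unfolding f by (simp add: algebra_simps)
  then show ?thesis
    by (intro that[of "v * of_nat N - u * A" w]) simp
qed

theorem theorem4:
  fixes f :: "int poly" and N k :: nat and a :: "nat \<Rightarrow> int poly"
  assumes "lead_coeff f = 1" and "Factorial_Ring.irreducible f" and "monogenic f"
    and "N > 0" and "\<not> perfect_power N"
    and "\<And>i. i \<in> {1..k} \<Longrightarrow> lead_coeff (a i) = 1"
    and "\<And>i. i \<in> {1..k} \<Longrightarrow>
      \<exists>f1 A :: int poly. f = f1 * of_nat N + a i * A \<and>
        Idl\<^bsub>ring_of_type_algebra\<^esub> {f1, a i, of_nat N} = UNIV"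
  defines "K \<equiv> number_field f"
    and "OK \<equiv> ring_of_integers f"
    and "\<alpha> \<equiv> root_class f"
  shows "(\<Otimes>\<^bsub>ideals_set OK\<^esub>i\<in>{1..k}. Idl\<^bsub>OK\<^esub> {add_pow OK N \<one>\<^bsub>OK\<^esub>, int_poly_eval K \<alpha> (a i)}) =
    Idl\<^bsub>OK\<^esub> {add_pow OK (N ^ k) \<one>\<^bsub>OK\<^esub>, \<Otimes>\<^bsub>OK\<^esub>i\<in>{1..k}. int_poly_eval K \<alpha> (a i)}"
proof -
  let ?h = "int_poly_class f"
  interpret h: ring_hom_cring ring_of_type_algebra OK ?h
    unfolding OK_def using assms(1,3) by (rule ring_hom_cring_ring_of_integers)
  have eval: "int_poly_eval K \<alpha> p = ?h p" for p
    by (simp add: K_def \<alpha>_def int_poly_eval_root_class)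
  have const: "add_pow OK n \<one>\<^bsub>OK\<^esub> = ?h (of_nat n)" for n
  proof (induction n)
    case (Suc n)
    then show ?case
      using h.hom_one h.hom_add[of "of_nat n" 1] by (simp add: add.commute)
  qed (use h.hom_zero in simp)
  have pow: "?h (x ^ n) = ?h x [^]\<^bsub>OK\<^esub> n" for x n
  proof (induction n)
    case (Suc n)
    then show ?case
      using h.hom_mult[of "x ^ n" x] by (simp add: mult.commute)
  qed (use h.hom_one in simp)
  have mem: "?h (of_nat N) \<in> Idl\<^bsub>OK\<^esub> {?h (a i), ?h (of_nat N) \<otimes>\<^bsub>OK\<^esub> ?h (of_nat N)}"
    if i: "i \<in> {1..k}" for i
  proof -
    obtain f1 A where "f = f1 * of_nat N + a i * A"
      "Idl\<^bsub>ring_of_type_algebra\<^esub> {f1, a i, of_nat N} = UNIV"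
      using assms(7)[OF i] by blast
    then obtain c w where "f dvd of_nat N - (c * a i + w * (of_nat N * of_nat N))"
      by (rule self_mem_genideal_modulo)
    then have "?h (of_nat N - (c * a i + w * (of_nat N * of_nat N))) = \<zero>\<^bsub>OK\<^esub>"
      by (simp add: int_poly_class_eq_zero OK_def ring_of_integers_def)
    then have "?h (of_nat N) = ?h (c * a i + w * (of_nat N * of_nat N))"
      using h.hom_add[of "of_nat N - (c * a i + w * (of_nat N * of_nat N))"
          "c * a i + w * (of_nat N * of_nat N)"] h.hom_closed by simp
    also have "\<dots> = ?h c \<otimes>\<^bsub>OK\<^esub> ?h (a i) \<oplus>\<^bsub>OK\<^esub> ?h w \<otimes>\<^bsub>OK\<^esub> (?h (of_nat N) \<otimes>\<^bsub>OK\<^esub> ?h (of_nat N))"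
      using h.hom_add h.hom_mult by simp
    also have "\<dots> \<in> Idl\<^bsub>OK\<^esub> {?h (a i), ?h (of_nat N) \<otimes>\<^bsub>OK\<^esub> ?h (of_nat N)}"
      by (rule h.S.in_genideal_pairI) simp_all
    finally show ?thesis .
  qed
  show ?thesis
    unfolding eval const of_nat_power pow
    using h.S.finprod_genideal_pair[of "{1..k}" "?h (of_nat N)" "\<lambda>i. ?h (a i)"] mem h.hom_closed
    by simp
qed

end
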